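(* For every positive integer $k$, the class $\overrightarrow{\mathcal D}^+_k$ is a Ramsey class.
   Context: For a set $A$, $\binom{A}{i}$ denotes the set of all $i$-element subsets of $A$. A $k$-orientation is an oriented graph (directed graph with no loops and no pair of opposite arcs) in which every vertex has out-degree at most $k$. $\mathcal D_k$ denotes the class of all finite $k$-orientations. For $G=(V,E)\in\mathcal D_k$, $\mathbf G^+$ is the structure with vertex set $V$ and partial unary functions $F^1,\dots,F^k$, where for $1\le i\le k$ the function $F^i$ takes values in $\binom{V}{i}$, is defined exactly on the vertices of out-degree $i$, and maps each such vertex to the set of all vertices in its out-neighbourhood. $\mathcal D_k^+$ is the class of all structures $\mathbf G^+$ with $G\in\mathcal D_k$. $\overrightarrow{\mathcal D}^+_k$ is the class of all structures $\overrightarrow{\mathbf A}=(A,\leq_{\mathbf A},F^1_{\mathbf A},\dots,F^k_{\mathbf A})$ such that $(A,F^1_{\mathbf A},\dots,F^k_{\mathbf A})\in\mathcal D_k^+$ and $\leq_{\mathbf A}$ is a linear order of $A$. Embedding: a map $f:A\to B$ is an embedding $\overrightarrow{\mathbf A}\to\overrightarrow{\mathbf B}$ if it is an order-preserving injection such that for every $i$ and every $x\in A$: $x\in\mathrm{Dom}(F^i_{\mathbf A})$ if and only if $f(x)\in\mathrm{Dom}(F^i_{\mathbf B})$, and in that case $F^i_{\mathbf B}(f(x))=f(F^i_{\mathbf A}(x))$ (image of a set). (Thus substructures correspond to successor-closed subgraphs.) Copies: a copy of $\mathbf A$ in $\mathbf B$ is the image $f(\mathbf A)$ of an embedding $f:\mathbf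 A\to\mathbf B$. $\binom{\mathbf B}{\mathbf A}$ denotes the set of all copies of $\mathbf A$ in $\mathbf B$. Ramsey class: a class $\mathcal C$ of structures with embeddings is a Ramsey class if for all $\mathbf A,\mathbf B\in\mathcal C$ and every positive integer $r$ there exists $\mathbf C\in\mathcal C$ such that for every partition of $\binom{\mathbf C}{\mathbf A}$ into $r$ classes there is $\widetilde{\mathbf B}\in\binom{\mathbf C}{\mathbf B}$ such that $\binom{\widetilde{\mathbf B}}{\mathbf A}$ is contained in one class of the partition. *)

theory Defs
  imports "Graph_Theory.Pair_Digraph" "HOL-Library.Disjoint_Sets"
begin

section \<open>Orientations\<close>

text \<open>\<^locale>\<open>pair_digraph\<close> means finite and loopless, with the arcs being a set of pairs of
  vertices (hence no parallel arcs); \<^term>\<open>asym (parcs G)\<close> excludes pairs of opposite arcs.\<close>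

definition k_orientation :: "nat \<Rightarrow> 'v pair_pre_digraph \<Rightarrow> bool" where
  "k_orientation k G \<longleftrightarrow>
     pair_digraph G \<and> asym (parcs G) \<and>
     (\<forall>v\<in>pverts G. out_degree (with_proj G) v \<le> k)"

definition out_nbhd :: "'v pair_pre_digraph \<Rightarrow> 'v \<Rightarrow> 'v set" where
  "out_nbhd G v = {w. (v, w) \<in> parcs G}"


section \<open>Structures with partial set-valued unary functions\<close>

text \<open>\<open>fn A i\<close> is the partial function \<open>F\<^sup>i\<close>. For indices outside \<open>{1..k}\<close> and for points
  outside the carrier it is required to be undefined (see \<open>plus_structure\<close>), so that
  equality of records is equality of structures.\<close>

record 'v fstruct =
  carr :: "'v set"
  fn :: "nat \<Rightarrow> 'v \<rightharpoonup> 'v set"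

record 'v ord_fstruct = "'v fstruct" +
  le :: "'v rel"

definition plus_structure :: "nat \<Rightarrow> 'v pair_pre_digraph \<Rightarrow> 'v fstruct" where
  "plus_structure k G =
     \<lparr> carr = pverts G,
       fn = (\<lambda>i v. if i \<in> {1..k} \<and> v \<in> pverts G \<and> out_degree (with_proj G) v = i
                   then Some (out_nbhd G v) else None) \<rparr>"

definition D_plus :: "nat \<Rightarrow> 'v fstruct set" where
  "D_plus k = {plus_structure k G | G. k_orientation k G}"

text \<open>\<^const>\<open>fstruct.truncate\<close> forgets the order.  Note that \<^const>\<open>linear_order_on\<close> is the
  reflexive version and includes that the relation lives on the carrier.

  Vertices are drawn from the type \<open>'v\<close>; if \<open>'v\<close> is infinite, every finite structure is
  isomorphic to one over \<open>'v\<close>.\<close>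

definition ord_D_plus :: "nat \<Rightarrow> 'v ord_fstruct set" where
  "ord_D_plus k =
     {A. fstruct.truncate A \<in> D_plus k \<and> linear_order_on (carr A) (le A)}"


section \<open>Embeddings and copies\<close>

definition embedding :: "('v \<Rightarrow> 'v) \<Rightarrow> 'v ord_fstruct \<Rightarrow> 'v ord_fstruct \<Rightarrow> bool" where
  "embedding f A B \<longleftrightarrow>
     f ` carr A \<subseteq> carr B \<and> inj_on f (carr A) \<and>
     (\<forall>x\<in>carr A. \<forall>y\<in>carr A. (x, y) \<in> le A \<longrightarrow> (f x, f y) \<in> le B) \<and>
     (\<forall>i. \<forall>x\<in>carr A.
        (x \<in> dom (fn A i) \<longleftrightarrow> f x \<in> dom (fn B i)) \<and>
        (x \<in> dom (fn A i) \<longrightarrow> the (fn B i (f x)) = f ` the (fn A i x)))"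

text \<open>The image \<open>f(A)\<close> is the structure on the image of the carrier obtained by transporting
  the order and the functions along \<open>f\<close>, which is meant to be injective on the carrier.\<close>

definition image_struct :: "('v \<Rightarrow> 'v) \<Rightarrow> 'v ord_fstruct \<Rightarrow> 'v ord_fstruct" where
  "image_struct f A =
     \<lparr> carr = f ` carr A,
       fn = (\<lambda>i y. if y \<in> f ` carr A
                   then map_option ((`) f) (fn A i (inv_into (carr A) f y)) else None),
       le = map_prod f f ` le A \<rparr>"

definition copies :: "'v ord_fstruct \<Rightarrow> 'v ord_fstruct \<Rightarrow> 'v ord_fstruct set" where
  "copies A B = {image_struct f A | f. embedding f A B}"


section \<open>Ramsey classes\<close>

text \<open>Partitions into \<open>r\<close> classes are colourings by \<open>r\<close> colours: classes may be empty.
  (If they had to be nonempty, any \<open>C\<close> with fewer than \<open>r\<close> copies of \<open>A\<close> would do.)\<close>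

definition partition_into :: "nat \<Rightarrow> (nat \<Rightarrow> 's set) \<Rightarrow> 's set \<Rightarrow> bool" where
  "partition_into r P S \<longleftrightarrow> disjoint_family_on P {..<r} \<and> (\<Union>i<r. P i) = S"

definition ramsey_class :: "'v ord_fstruct set \<Rightarrow> bool" where
  "ramsey_class \<C> \<longleftrightarrow>
     (\<forall>A\<in>\<C>. \<forall>B\<in>\<C>. \<forall>r\<ge>1. \<exists>C\<in>\<C>. \<forall>P. partition_into r P (copies A C) \<longrightarrow>
        (\<exists>B'\<in>copies B C. \<exists>i<r. copies A B' \<subseteq> P i))"

end

theory Submission
  imports Defs "HOL-Library.Ramsey"
begin

text \<open>The functions being unary, vertices may be glued freely as long as each one knows its own
  closure; this makes the class Ramsey by the finite Ramsey theorem alone.  Let the vertices of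
  \<open>C\<close> be the pairs \<open>(p, R)\<close> with \<open>p < N\<close> and \<open>R\<close> a \<open>k\<close>-orientation on \<open>{..<N}\<close>, ordered primarily by
  \<open>p\<close>; the out-neighbours of \<open>(p, R)\<close> are the \<open>(q, R\<^sub>q)\<close> with \<open>(p, q) \<in> R\<close>, where \<open>R\<^sub>q\<close> is the part of
  \<open>R\<close> reachable from \<open>q\<close>.  Any structure with arcs \<open>S\<close> on a set of positions embeds into \<open>C\<close> by
  \<open>p \<mapsto> (p, S\<^sub>p)\<close>.  Inside such a copy of \<open>B\<close> every copy of \<open>A\<close> has distinct positions and is
  determined by them, because \<open>A\<close> is successor-closed.  So a colouring of the copies of \<open>A\<close> becomes
  a colouring of the \<open>|A|\<close>-subsets of \<open>{..<N}\<close>, and a homogeneous \<open>|B|\<close>-subset carries the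
  required copy of \<open>B\<close>.\<close>

section \<open>Structures from arc relations\<close>

text \<open>A bare vertex set with an arc relation transports along injections more easily than a
  digraph record. \<open>asym\<close> rules out loops as well as opposite arcs.\<close>

definition k_arcs :: "nat \<Rightarrow> 'v set \<Rightarrow> 'v rel \<Rightarrow> bool" where
  "k_arcs k V R \<longleftrightarrow> finite V \<and> R \<subseteq> V \<times> V \<and> asym R \<and> (\<forall>v\<in>V. card (R `` {v}) \<le> k)"

definition struct_of :: "nat \<Rightarrow> 'v set \<Rightarrow> 'v rel \<Rightarrow> 'v rel \<Rightarrow> 'v ord_fstruct" where
  "struct_of k V R L =
     \<lparr> carr = V,
       fn = (\<lambda>i v. if i \<in> {1..k} \<and> v \<in> V \<and> card (R `` {v}) = i then Some (R `` {v}) else None),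
       le = L \<rparr>"

lemma struct_of_simps [simp]:
  "carr (struct_of k V R L) = V" "le (struct_of k V R L) = L"
  by (auto simp: struct_of_def)

lemma k_arcs_finite_Image: "k_arcs k V R \<Longrightarrow> finite (R `` {v})"
  unfolding k_arcs_def by (rule finite_subset[of _ V]) auto

lemma out_degree_with_proj: "out_degree (with_proj G) v = card (parcs G `` {v})"
proof -
  have "out_arcs (with_proj G) v = Pair v ` (parcs G `` {v})"
    by (auto simp: out_arcs_def)
  then show ?thesis
    by (simp add: out_degree_def card_image inj_on_def)
qed

lemma k_orientation_iff: "k_orientation k G \<longleftrightarrow> k_arcs k (pverts G) (parcs G)"
proof
  assume k: "k_orientation k G"
  then interpret pair_digraph G
    by (simp add: k_orientation_def)
  show "k_arcs k (pverts G) (parcs G)"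
    using k in_arcsD1 in_arcsD2 pair_finite_verts
    by (auto simp: k_arcs_def k_orientation_def out_degree_with_proj)
next
  assume k: "k_arcs k (pverts G) (parcs G)"
  then have "finite (parcs G)"
    unfolding k_arcs_def by (meson finite_SigmaI finite_subset)
  with k have "pair_digraph G"
    by unfold_locales (auto simp: k_arcs_def dest: asymD)
  with k show "k_orientation k G"
    by (simp add: k_arcs_def k_orientation_def out_degree_with_proj)
qed

lemma plus_structure_eq:
  "plus_structure k G = fstruct.truncate (struct_of k (pverts G) (parcs G) L)"
  by (auto simp: plus_structure_def struct_of_def fstruct.truncate_def out_nbhd_def
      out_degree_with_proj fun_eq_iff)

lemma struct_of_in_ord_D_plus:
  assumes "k_arcs k V R" "linear_order_on V L"
  shows "struct_of k V R L \<in> ord_D_plus k"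
proof -
  define G where "G = \<lparr>pverts = V, parcs = R\<rparr>"
  have "k_orientation k G"
    using assms by (simp add: k_orientation_iff G_def)
  moreover have "fstruct.truncate (struct_of k V R L) = plus_structure k G"
    using plus_structure_eq[of k G L] by (simp add: G_def)
  ultimately show ?thesis
    using assms by (auto simp: ord_D_plus_def D_plus_def)
qed

lemma ord_D_plusE:
  assumes "A \<in> ord_D_plus k"
  obtains V R L where "A = struct_of k V R L" "k_arcs k V R" "linear_order_on V L"
proof -
  obtain G where G: "k_orientation k G" "fstruct.truncate A = plus_structure k G"
    and L: "linear_order_on (carr A) (le A)"
    using assms by (auto simp: ord_D_plus_def D_plus_def)
  have "fstruct.truncate A = fstruct.truncate (struct_of k (pverts G) (parcs G) (le A))"
    using G(2) plus_structure_eq by metis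
  then have eq: "A = struct_of k (pverts G) (parcs G) (le A)"
    by (cases A) (simp add: fstruct.truncate_def struct_of_def)
  then have "linear_order_on (pverts G) (le A)"
    using L by (metis struct_of_simps(1))
  with eq G(1) that show thesis
    by (auto simp: k_orientation_iff)
qed

lemma image_arcs_Image:
  assumes "inj_on f V" "R \<subseteq> V \<times> V" "v \<in> V"
  shows "(map_prod f f ` R) `` {f v} = f ` (R `` {v})"
proof -
  have "x = v" if "(x, y) \<in> R" "f x = f v" for x y
    using assms that by (auto dest: inj_onD)
  then show ?thesis
    by force
qed

lemma map_prod_inj_mem:
  assumes "inj_on f V" "R \<subseteq> V \<times> V" "x \<in> V" "y \<in> V"
  shows "(f x, f y) \<in> map_prod f f ` R \<longleftrightarrow> (x, y) \<in> R"
  using assms by (auto dest: inj_onD)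

lemma k_arcs_image:
  assumes "inj_on f V" "k_arcs k V R"
  shows "k_arcs k (f ` V) (map_prod f f ` R)"
proof -
  have R: "R \<subseteq> V \<times> V" "asym R"
    using assms by (auto simp: k_arcs_def)
  have "asym (map_prod f f ` R)"
  proof
    fix x y assume "(x, y) \<in> map_prod f f ` R"
    then obtain a b where ab: "(a, b) \<in> R" "x = f a" "y = f b"
      by auto
    then have "(b, a) \<notin> R" "b \<in> V" "a \<in> V"
      using R by (auto dest: asymD)
    then show "(y, x) \<notin> map_prod f f ` R"
      by (simp only: ab(2,3) map_prod_inj_mem[OF assms(1) R(1)] not_False_eq_True)
  qed
  moreover have "card ((map_prod f f ` R) `` {f v}) \<le> k" if "v \<in> V" for v
  proof -
    have "card (f ` (R `` {v})) \<le> card (R `` {v})"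
      by (rule card_image_le[OF k_arcs_finite_Image[OF assms(2)]])
    then show ?thesis
      using assms(2) that image_arcs_Image[OF assms(1) R(1) that] by (auto simp: k_arcs_def)
  qed
  ultimately show ?thesis
    using assms(2) R(1) by (auto simp: k_arcs_def)
qed

lemma image_struct_struct_of:
  assumes "inj_on f V" "R \<subseteq> V \<times> V"
  shows "image_struct f (struct_of k V R L) =
    struct_of k (f ` V) (map_prod f f ` R) (map_prod f f ` L)"
proof -
  have "card (f ` (R `` {v})) = card (R `` {v})" for v
    by (rule card_image, rule inj_on_subset[OF assms(1)]) (use assms(2) in auto)
  then show ?thesis
    using assms
    by (auto simp: image_struct_def struct_of_def fun_eq_iff image_arcs_Image)
qed

text \<open>Two enumerations that agree on the carrier may differ elsewhere; the copies they produce
  must still be equal as records.\<close>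

lemma image_struct_cong:
  assumes "\<And>x. x \<in> V \<Longrightarrow> f x = g x" "R \<subseteq> V \<times> V" "L \<subseteq> V \<times> V" "inj_on f V"
  shows "image_struct f (struct_of k V R L) = image_struct g (struct_of k V R L)"
proof -
  have eq: "map_prod f f ` S = map_prod g g ` S" if "S \<subseteq> V \<times> V" for S
    using that assms(1) by (intro image_cong) auto
  have "inj_on g V"
    using assms(1,4) by (simp add: inj_on_def)
  moreover have "f ` V = g ` V"
    using assms(1) by (rule image_cong[OF refl])
  ultimately show ?thesis
    by (simp only: image_struct_struct_of assms(2,4) eq[OF assms(2)] eq[OF assms(3)])
qed

text \<open>A vertex with successors lies in the domain of exactly one function, the one indexed by
  its out-degree, and a sink lies in none. So the functions together carry exactly the
  out-neighbourhoods, and preserving the latter under an injection also preserves the index.\<close>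

lemma embedding_struct_of_iff:
  assumes R: "k_arcs k V R" and S: "k_arcs k W S"
  shows "embedding f (struct_of k V R L) (struct_of k W S M) \<longleftrightarrow>
    f ` V \<subseteq> W \<and> inj_on f V \<and> (\<forall>x\<in>V. \<forall>y\<in>V. (x, y) \<in> L \<longrightarrow> (f x, f y) \<in> M) \<and>
    (\<forall>x\<in>V. S `` {f x} = f ` (R `` {x}))"
    (is "_ \<longleftrightarrow> ?rhs")
proof
  assume e: "embedding f (struct_of k V R L) (struct_of k W S M)"
  then have fV: "f ` V \<subseteq> W"
    by (simp add: embedding_def)
  have "S `` {f x} = f ` (R `` {x})" if x: "x \<in> V" for x
  proof (cases "R `` {x} = {}")
    case True
    then have "x \<notin> dom (fn (struct_of k V R L) i)" for i
      by (auto simp: struct_of_def dom_def split: if_splits)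
    then have "f x \<notin> dom (fn (struct_of k W S M) i)" for i
      using e x by (simp add: embedding_def)
    \<comment> \<open>A positive out-degree of \<open>f x\<close> would be an index in
      \<open>{1..k}\<close> whose function is defined at \<open>f x\<close>.\<close>
    from this[of "card (S `` {f x})"] have "card (S `` {f x}) = 0"
      using S fV x by (force simp: struct_of_def dom_def k_arcs_def split: if_splits)
    then show ?thesis
      using True k_arcs_finite_Image[OF S] by simp
  next
    case False
    then have "card (R `` {x}) \<noteq> 0"
      using k_arcs_finite_Image[OF R] by simp
    moreover have "card (R `` {x}) \<le> k"
      using R x by (simp add: k_arcs_def)
    ultimately have "x \<in> dom (fn (struct_of k V R L) (card (R `` {x})))"
      "the (fn (struct_of k V R L) (card (R `` {x})) x) = R `` {x}"
      using x by (auto simp: struct_of_def)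
    then have "f x \<in> dom (fn (struct_of k W S M) (card (R `` {x})))"
      "the (fn (struct_of k W S M) (card (R `` {x})) (f x)) = f ` (R `` {x})"
      using e x by (auto simp: embedding_def)
    then show ?thesis
      by (auto simp: struct_of_def dom_def split: if_splits)
  qed
  with e show ?rhs
    by (auto simp: embedding_def)
next
  assume f: ?rhs
  have "card (f ` (R `` {x})) = card (R `` {x})" for x
    by (rule card_image, rule inj_on_subset[of f V]) (use f R in \<open>auto simp: k_arcs_def\<close>)
  with f show "embedding f (struct_of k V R L) (struct_of k W S M)"
    by (auto simp: embedding_def struct_of_def dom_def split: if_splits)
qed


section \<open>Strictly increasing enumerations\<close>

definition increasing_on :: "'v set \<Rightarrow> 'v rel \<Rightarrow> ('v \<Rightarrow> nat) \<Rightarrow> bool" where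
  "increasing_on V L \<phi> \<longleftrightarrow> (\<forall>x\<in>V. \<forall>y\<in>V. (x, y) \<in> L \<and> x \<noteq> y \<longrightarrow> \<phi> x < \<phi> y)"

lemma increasing_on_less_iff:
  assumes "linear_order_on V L" "increasing_on V L \<phi>" "x \<in> V" "y \<in> V"
  shows "\<phi> x < \<phi> y \<longleftrightarrow> (x, y) \<in> L \<and> x \<noteq> y"
proof
  assume less: "\<phi> x < \<phi> y"
  then have "x \<noteq> y" "(y, x) \<notin> L"
    using assms less_asym unfolding increasing_on_def by blast+
  then show "(x, y) \<in> L \<and> x \<noteq> y"
    using assms by (auto simp: order_on_defs total_on_def)
qed (use assms in \<open>auto simp: increasing_on_def\<close>)

lemma increasing_on_inj_on:
  assumes "linear_order_on V L" "increasing_on V L \<phi>"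
  shows "inj_on \<phi> V"
proof (rule inj_onI, rule ccontr)
  fix x y assume "x \<in> V" "y \<in> V" "\<phi> x = \<phi> y" "x \<noteq> y"
  moreover from this have "(x, y) \<in> L \<or> (y, x) \<in> L"
    using assms(1) by (auto simp: order_on_defs total_on_def)
  ultimately show False
    using assms(2) by (metis increasing_on_def less_irrefl)
qed

text \<open>Count strict predecessors to map \<open>V\<close> onto an initial segment of the
  naturals, then follow with the increasing enumeration of \<open>Y\<close>.\<close>

lemma ex_increasing_on:
  assumes "finite V" "linear_order_on V L" "finite Y" "card Y = card V"
  obtains \<phi> where "increasing_on V L \<phi>" "\<phi> ` V = Y"
proof -
  define rk where "rk x = card {y\<in>V. (y, x) \<in> L \<and> y \<noteq> x}" for x
  have anti: "antisym L" and tr: "trans L"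
    using assms by (auto simp: order_on_defs)
  have inc: "increasing_on V L rk"
    unfolding increasing_on_def
  proof (intro ballI impI)
    fix x y assume xy: "x \<in> V" "y \<in> V" "(x, y) \<in> L \<and> x \<noteq> y"
    then have "{z\<in>V. (z, x) \<in> L \<and> z \<noteq> x} \<subseteq> {z\<in>V. (z, y) \<in> L \<and> z \<noteq> y} - {x}"
      using anti tr by (auto dest: transD antisymD)
    moreover have "x \<in> {z\<in>V. (z, y) \<in> L \<and> z \<noteq> y}"
      using xy by simp
    ultimately have "{z\<in>V. (z, x) \<in> L \<and> z \<noteq> x} \<subset> {z\<in>V. (z, y) \<in> L \<and> z \<noteq> y}"
      by blast
    then show "rk x < rk y"
      unfolding rk_def using assms(1) by (intro psubset_card_mono) auto
  qed
  have "rk x < card V" if "x \<in> V" for x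
    unfolding rk_def using assms(1) that by (intro psubset_card_mono) auto
  then have "rk ` V \<subseteq> {..<card V}"
    by auto
  moreover have "card (rk ` V) = card V"
    by (rule card_image[OF increasing_on_inj_on[OF assms(2) inc]])
  ultimately have rkV: "rk ` V = {..<card Y}"
    using assms(4) by (intro card_subset_eq) auto
  obtain h where h: "bij_betw h {..<card Y} Y" "strict_mono_on {..<card Y} h"
    using ex_bij_betw_strict_mono_card[OF assms(3)] by blast
  show thesis
  proof
    show "increasing_on V L (h \<circ> rk)"
      unfolding increasing_on_def
    proof (intro ballI impI)
      fix x y assume xy: "x \<in> V" "y \<in> V" "(x, y) \<in> L \<and> x \<noteq> y"
      then have "rk x \<in> {..<card Y}" "rk y \<in> {..<card Y}" "rk x < rk y"
        using rkV inc by (auto simp: increasing_on_def)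
      then show "(h \<circ> rk) x < (h \<circ> rk) y"
        using h(2) by (simp add: strict_mono_on_def)
    qed
    show "(h \<circ> rk) ` V = Y"
      using rkV h(1) by (metis bij_betw_imp_surj_on image_comp)
  qed
qed

text \<open>The number of elements of the image below the value at \<open>x\<close> is the number of
  strict predecessors of \<open>x\<close>, whichever map is used; and an element of a finite set of
  naturals is determined by how many elements lie below it.\<close>

lemma increasing_on_unique:
  assumes "finite V" "linear_order_on V L"
    and "increasing_on V L \<phi>" "increasing_on V L \<psi>" "\<phi> ` V = \<psi> ` V" "x \<in> V"
  shows "\<phi> x = \<psi> x"
proof -
  let ?Y = "\<phi> ` V"
  have below: "card {y\<in>\<theta> ` V. y < \<theta> x} = card {z\<in>V. (z, x) \<in> L \<and> z \<noteq> x}"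
    if \<theta>: "increasing_on V L \<theta>" for \<theta>
  proof -
    have "{y\<in>\<theta> ` V. y < \<theta> x} = \<theta> ` {z\<in>V. (z, x) \<in> L \<and> z \<noteq> x}"
      using increasing_on_less_iff[OF assms(2) \<theta> _ assms(6)] by auto
    moreover have "inj_on \<theta> {z\<in>V. (z, x) \<in> L \<and> z \<noteq> x}"
      by (rule inj_on_subset[OF increasing_on_inj_on[OF assms(2) \<theta>]]) auto
    ultimately show ?thesis
      by (simp add: card_image)
  qed
  have eq: "card {y\<in>?Y. y < \<phi> x} = card {y\<in>?Y. y < \<psi> x}"
    using below[OF assms(3)] below[OF assms(4)] assms(5) by simp
  have less: "card {y\<in>?Y. y < a} < card {y\<in>?Y. y < b}" if "a \<in> ?Y" "a < b" for a b
  proof (rule psubset_card_mono)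
    have "a \<in> {y\<in>?Y. y < b}" "a \<notin> {y\<in>?Y. y < a}"
      using that by auto
    moreover have "{y\<in>?Y. y < a} \<subseteq> {y\<in>?Y. y < b}"
      using that by auto
    ultimately show "{y\<in>?Y. y < a} \<subset> {y\<in>?Y. y < b}"
      by blast
  qed (use assms in auto)
  have "\<phi> x \<in> ?Y" "\<psi> x \<in> ?Y"
    using assms(5,6) by auto
  then show ?thesis
    using less[of "\<phi> x" "\<psi> x"] less[of "\<psi> x" "\<phi> x"] eq by (metis less_irrefl nat_neq_iff)
qed


section \<open>The universal structure\<close>

text \<open>Reachability is asked of the tail only, since the head of such an arc is then reachable
  too: these are the arcs of the smallest successor-closed substructure containing
  \<open>p\<close>.\<close>

definition generated :: "'a rel \<Rightarrow> 'a \<Rightarrow> 'a rel" where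
  "generated R p = {(x, y)\<in>R. (p, x) \<in> R\<^sup>*}"

lemma generated_Image: "generated R p `` {p} = R `` {p}"
  by (auto simp: generated_def)

lemma generated_subset: "generated R p \<subseteq> R"
  by (auto simp: generated_def)

text \<open>\<open>Y\<close> is successor-closed, so a walk from \<open>p\<close> never leaves it
  and uses only arcs on which the two relations agree.\<close>

lemma generated_cong:
  assumes "\<And>x. x \<in> Y \<Longrightarrow> R `` {x} = S `` {x} \<and> R `` {x} \<subseteq> Y" "p \<in> Y"
  shows "generated R p = generated S p"
proof -
  have R: "x \<in> Y \<and> (p, x) \<in> S\<^sup>*" if "(p, x) \<in> R\<^sup>*" for x
    using that
  proof induction
    case (step x y)
    then show ?case
      using assms(1)[of x] by (auto intro: rtrancl_into_rtrancl)
  qed (use assms in simp)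
  have S: "x \<in> Y \<and> (p, x) \<in> R\<^sup>*" if "(p, x) \<in> S\<^sup>*" for x
    using that
  proof induction
    case (step x y)
    then show ?case
      using assms(1)[of x] by (auto intro: rtrancl_into_rtrancl)
  qed (use assms in simp)
  have "(x, y) \<in> R \<longleftrightarrow> (x, y) \<in> S" if "x \<in> Y" for x y
    using assms(1)[OF that] by auto
  then show ?thesis
    unfolding generated_def using R S by blast
qed

text \<open>Whatever \<open>q\<close> reaches is reached from \<open>p\<close> as well, so
  restricting to \<open>p\<close> first loses no arc that \<open>q\<close> needs. This makes the
  prescriptions stored in the vertices consistent along arcs.\<close>

lemma generated_generated:
  assumes "(p, q) \<in> R"
  shows "generated (generated R p) q = generated R q"
proof (rule generated_cong[symmetric, of "{x. (q, x) \<in> R\<^sup>*}"])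
  fix x assume "x \<in> {x. (q, x) \<in> R\<^sup>*}"
  then have "(p, x) \<in> R\<^sup>*" "(q, x) \<in> R\<^sup>*"
    using assms by auto
  then show "R `` {x} = generated R p `` {x} \<and> R `` {x} \<subseteq> {x. (q, x) \<in> R\<^sup>*}"
    by (auto simp: generated_def intro: rtrancl_into_rtrancl)
qed simp

text \<open>A vertex \<open>(p, R)\<close> is a position together with a prescription of the structure that the
  vertex generates.\<close>

definition univ_verts :: "nat \<Rightarrow> nat \<Rightarrow> (nat \<times> nat rel) set" where
  "univ_verts k N = {..<N} \<times> {R. k_arcs k {..<N} R}"

definition univ_arcs :: "nat \<Rightarrow> nat \<Rightarrow> (nat \<times> nat rel) rel" where
  "univ_arcs k N =
     {((p, R), (q, generated R q)) | p R q. (p, R) \<in> univ_verts k N \<and> (p, q) \<in> R}"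

lemma k_arcs_subset:
  assumes "k_arcs k V R" "S \<subseteq> R"
  shows "k_arcs k V S"
proof -
  have "card (S `` {v}) \<le> k" if "v \<in> V" for v
  proof -
    have "card (S `` {v}) \<le> card (R `` {v})"
      by (rule card_mono[OF k_arcs_finite_Image[OF assms(1)]]) (use assms(2) in auto)
    then show ?thesis
      using assms(1) that by (auto simp: k_arcs_def intro: order_trans)
  qed
  moreover have "asym S"
    using assms unfolding k_arcs_def by (meson asymD asymI subsetD)
  ultimately show ?thesis
    using assms by (auto simp: k_arcs_def)
qed

lemma univ_arcs_Image:
  assumes "(p, R) \<in> univ_verts k N"
  shows "univ_arcs k N `` {(p, R)} = (\<lambda>q. (q, generated R q)) ` (R `` {p})"
  using assms by (auto simp: univ_arcs_def)

lemma finite_univ_verts: "finite (univ_verts k N)"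
proof -
  have "{R. k_arcs k {..<N} R} \<subseteq> Pow ({..<N} \<times> {..<N})"
    by (auto simp: k_arcs_def)
  then have "finite {R. k_arcs k {..<N} R}"
    by (rule finite_subset) simp
  then show ?thesis
    by (simp add: univ_verts_def)
qed

text \<open>Out-neighbours of \<open>(p, R)\<close> are indexed by those of \<open>p\<close> in
  \<open>R\<close>, which bounds the degree. An arc back from \<open>(q, generated R q)\<close> to
  position \<open>p\<close> would put both \<open>(p, q)\<close> and \<open>(q, p)\<close> into
  \<open>R\<close>.\<close>

lemma k_arcs_univ: "k_arcs k (univ_verts k N) (univ_arcs k N)"
proof -
  have "univ_arcs k N \<subseteq> univ_verts k N \<times> univ_verts k N"
  proof
    fix e assume "e \<in> univ_arcs k N"
    then obtain p R q where e: "e = ((p, R), (q, generated R q))" "(p, q) \<in> R"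
      and v: "(p, R) \<in> univ_verts k N"
      by (auto simp: univ_arcs_def)
    have "k_arcs k {..<N} R"
      using v by (simp add: univ_verts_def)
    then have "q < N"
      using e(2) by (auto simp: k_arcs_def)
    moreover have "k_arcs k {..<N} (generated R q)"
      by (rule k_arcs_subset[OF \<open>k_arcs k {..<N} R\<close> generated_subset])
    ultimately show "e \<in> univ_verts k N \<times> univ_verts k N"
      using e v by (simp add: univ_verts_def)
  qed
  moreover have "asym (univ_arcs k N)"
  proof
    fix x y assume "(x, y) \<in> univ_arcs k N"
    then obtain p R q where "x = (p, R)" "y = (q, generated R q)" "(p, q) \<in> R" "asym R"
      by (auto simp: univ_arcs_def univ_verts_def k_arcs_def)
    then show "(y, x) \<notin> univ_arcs k N"
      using generated_subset[of R q] by (auto simp: univ_arcs_def dest: asymD)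
  qed
  moreover have "card (univ_arcs k N `` {v}) \<le> k" if v: "v \<in> univ_verts k N" for v
  proof -
    obtain p R where pR: "v = (p, R)" by (cases v)
    then have R: "k_arcs k {..<N} R" "p < N"
      using v by (auto simp: univ_verts_def)
    have "card (univ_arcs k N `` {v}) \<le> card (R `` {p})"
      using v k_arcs_finite_Image[OF R(1)] by (simp add: pR univ_arcs_Image card_image_le)
    also have "\<dots> \<le> k"
      using R by (simp add: k_arcs_def)
    finally show ?thesis .
  qed
  ultimately show ?thesis
    using finite_univ_verts by (simp add: k_arcs_def)
qed

text \<open>Only the order between different positions is prescribed; vertices sharing a position
  are ordered arbitrarily.\<close>

lemma ex_univ_order:
  obtains M where "linear_order_on (univ_verts k N) M"
    and "\<And>x y. x \<in> univ_verts k N \<Longrightarrow> y \<in> univ_verts k N \<Longrightarrow> fst x < fst y \<Longrightarrow> (x, y) \<in> M"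
proof -
  let ?U = "univ_verts k N"
  obtain e :: "nat \<times> nat rel \<Rightarrow> nat" and m where e: "e ` ?U = {i. i < m}" "inj_on e ?U"
    using finite_imp_inj_to_nat_seg[OF finite_univ_verts] by metis
  \<comment> \<open>A lexicographic code: since \<open>e x < m\<close>, the position dominates and
    \<open>e\<close> breaks ties.\<close>
  define key where "key x = fst x * m + e x" for x
  have em: "e x < m" if "x \<in> ?U" for x
    using e that by auto
  have key_less: "key x < key y" if "x \<in> ?U" "fst x < fst y" for x y
  proof -
    have "key x < Suc (fst x) * m"
      using em[OF that(1)] by (simp add: key_def)
    also have "\<dots> \<le> fst y * m"
      using that(2) by (intro mult_le_mono1) simp
    finally show ?thesis
      by (simp add: key_def)
  qed
  have key_inj: "x = y" if "x \<in> ?U" "y \<in> ?U" "key x = key y" for x y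
  proof -
    have "fst x = fst y"
      using that key_less[of x y] key_less[of y x] by (metis less_irrefl nat_neq_iff)
    then show ?thesis
      using that e(2) by (auto simp: key_def dest: inj_onD)
  qed
  define M where "M = {(x, y). x \<in> ?U \<and> y \<in> ?U \<and> key x \<le> key y}"
  show thesis
  proof
    have "antisym M"
      using key_inj unfolding M_def antisym_def by (blast dest: order_antisym)
    then show "linear_order_on ?U M"
      by (auto simp: order_on_defs refl_on_def total_on_def M_def intro!: transI)
  qed (use key_less in \<open>auto simp: M_def intro: less_imp_le\<close>)
qed

lemma linear_order_on_image:
  assumes "inj_on f V" "linear_order_on V L"
  shows "linear_order_on (f ` V) (map_prod f f ` L)"
proof -
  have L: "L \<subseteq> V \<times> V" "refl_on V L" "trans L" "antisym L" "total_on V L"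
    using assms(2) by (auto simp: order_on_defs)
  note mem = map_prod_inj_mem[OF assms(1) L(1)]
  have sub: "map_prod f f ` L \<subseteq> f ` V \<times> f ` V"
    using L(1) by auto
  have "trans (map_prod f f ` L)"
  proof (rule transI)
    fix x y z assume xyz: "(x, y) \<in> map_prod f f ` L" "(y, z) \<in> map_prod f f ` L"
    then obtain a b c where "a \<in> V" "b \<in> V" "c \<in> V" "x = f a" "y = f b" "z = f c"
      using sub by blast
    then show "(x, z) \<in> map_prod f f ` L"
      using xyz L(3) by (auto simp only: mem dest: transD)
  qed
  moreover have "antisym (map_prod f f ` L)"
  proof (rule antisymI)
    fix x y assume xy: "(x, y) \<in> map_prod f f ` L" "(y, x) \<in> map_prod f f ` L"
    then obtain a b where "a \<in> V" "b \<in> V" "x = f a" "y = f b"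
      using sub by blast
    then show "x = y"
      using xy L(4) by (auto simp only: mem dest: antisymD)
  qed
  moreover have "refl_on (f ` V) (map_prod f f ` L)"
    using L(2) mem by (auto simp only: refl_on_def)
  moreover have "total_on (f ` V) (map_prod f f ` L)"
  proof (rule total_onI)
    fix x y assume xy: "x \<in> f ` V" "y \<in> f ` V" "x \<noteq> y"
    then obtain a b where "a \<in> V" "b \<in> V" "x = f a" "y = f b"
      by blast
    then show "(x, y) \<in> map_prod f f ` L \<or> (y, x) \<in> map_prod f f ` L"
      using xy(3) L(5) mem by (metis total_on_def)
  qed
  ultimately show ?thesis
    using sub by (simp add: order_on_defs)
qed

section \<open>Tags: placing structures inside the universal one\<close>

definition tag :: "('v \<Rightarrow> nat) \<Rightarrow> 'v rel \<Rightarrow> 'v \<Rightarrow> nat \<times> nat rel" where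
  "tag \<phi> R x = (\<phi> x, generated (map_prod \<phi> \<phi> ` R) (\<phi> x))"

lemma tag_cong:
  assumes "\<And>x. x \<in> V \<Longrightarrow> \<phi> x = \<psi> x" "R \<subseteq> V \<times> V" "x \<in> V"
  shows "tag \<phi> R x = tag \<psi> R x"
proof -
  have "map_prod \<phi> \<phi> ` R = map_prod \<psi> \<psi> ` R"
    using assms(1,2) by (intro image_cong) auto
  then show ?thesis
    using assms by (simp add: tag_def)
qed

text \<open>The tag of a vertex depends only on the substructure it generates, hence may be computed
  in any successor-closed substructure.\<close>

lemma tag_comp:
  assumes \<phi>: "inj_on \<phi> W" and g: "inj_on g V" "g ` V \<subseteq> W"
    and S: "S \<subseteq> W \<times> W" and R: "R \<subseteq> V \<times> V"
    and closed: "\<And>x. x \<in> V \<Longrightarrow> S `` {g x} = g ` (R `` {x})" and "x \<in> V"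
  shows "tag (\<phi> \<circ> g) R x = tag \<phi> S (g x)"
proof -
  let ?f = "\<phi> \<circ> g"
  have inj: "inj_on ?f V"
    using \<phi> g by (auto intro: comp_inj_on inj_on_subset)
  have "generated (map_prod ?f ?f ` R) (?f x) = generated (map_prod \<phi> \<phi> ` S) (?f x)"
  proof (rule generated_cong)
    fix y assume "y \<in> ?f ` V"
    then obtain v where v: "v \<in> V" "y = ?f v"
      by auto
    have "(map_prod ?f ?f ` R) `` {?f v} = ?f ` (R `` {v})"
      by (rule image_arcs_Image[OF inj R v(1)])
    moreover have "(map_prod \<phi> \<phi> ` S) `` {\<phi> (g v)} = \<phi> ` (S `` {g v})"
      by (rule image_arcs_Image[OF \<phi> S]) (use g v in auto)
    moreover have "R `` {v} \<subseteq> V"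
      using R by auto
    ultimately show "(map_prod ?f ?f ` R) `` {y} = (map_prod \<phi> \<phi> ` S) `` {y} \<and>
        (map_prod ?f ?f ` R) `` {y} \<subseteq> ?f ` V"
      using v closed[OF v(1)] by (auto simp: image_comp)
  qed (use assms in auto)
  then show ?thesis
    by (simp add: tag_def)
qed

text \<open>Strictly increasing positions take care of injectivity and order, and
  \<open>generated_generated\<close> of the successors. The injection \<open>h\<close> merely
  renames universal vertices into the type \<open>'v\<close>.\<close>

lemma tag_embedding:
  assumes R: "k_arcs k V R" and L: "linear_order_on V L"
    and \<phi>: "increasing_on V L \<phi>" "\<phi> ` V \<subseteq> {..<N}"
    and M: "linear_order_on (univ_verts k N) M"
      "\<And>x y. x \<in> univ_verts k N \<Longrightarrow> y \<in> univ_verts k N \<Longrightarrow> fst x < fst y \<Longrightarrow> (x, y) \<in> M"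
    and h: "inj_on h (univ_verts k N)"
  shows "embedding (h \<circ> tag \<phi> R) (struct_of k V R L)
    (struct_of k (h ` univ_verts k N) (map_prod h h ` univ_arcs k N) (map_prod h h ` M))"
proof -
  let ?U = "univ_verts k N" and ?R = "map_prod \<phi> \<phi> ` R" and ?t = "tag \<phi> R"
  have inj: "inj_on \<phi> V"
    by (rule increasing_on_inj_on[OF L \<phi>(1)])
  have RV: "R \<subseteq> V \<times> V"
    using R by (simp add: k_arcs_def)
  have kR': "k_arcs k (\<phi> ` V) ?R"
    by (rule k_arcs_image[OF inj R])
  \<comment> \<open>Universal vertices carry a relation on all of \<open>{..<N}\<close>; positions
    outside the image of \<open>\<phi>\<close> have no out-arcs, so the degree bound extends to
    them.\<close>
  have "card (?R `` {p}) \<le> k" for p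
  proof (cases "p \<in> \<phi> ` V")
    case False
    then have "?R `` {p} = {}"
      using RV by auto
    then show ?thesis
      by simp
  qed (use kR' in \<open>simp only: k_arcs_def\<close>)
  moreover have "?R \<subseteq> {..<N} \<times> {..<N}"
    using RV \<phi>(2) by auto
  ultimately have kR: "k_arcs k {..<N} ?R"
    using kR' by (simp add: k_arcs_def)
  have t: "?t x \<in> ?U" if "x \<in> V" for x
    using that \<phi>(2) k_arcs_subset[OF kR generated_subset]
    by (auto simp: tag_def univ_verts_def)
  have tinj: "inj_on ?t V"
    using inj by (auto simp: inj_on_def tag_def)
  have hinj: "inj_on (h \<circ> ?t) V"
    using t by (intro comp_inj_on tinj inj_on_subset[OF h]) auto
  \<comment> \<open>An arc out of the tag of \<open>x\<close> trims the already trimmed relation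
    once more; the result is what the successor's own tag contains.\<close>
  have succ: "univ_arcs k N `` {?t x} = ?t ` (R `` {x})" if x: "x \<in> V" for x
  proof -
    have Rx: "?R `` {\<phi> x} = \<phi> ` (R `` {x})"
      by (rule image_arcs_Image[OF inj RV x])
    have "univ_arcs k N `` {?t x} =
      (\<lambda>q. (q, generated (generated ?R (\<phi> x)) q)) ` (\<phi> ` (R `` {x}))"
      using univ_arcs_Image[of "\<phi> x" "generated ?R (\<phi> x)" k N] t[OF x]
      by (simp add: tag_def generated_Image Rx)
    also have "\<dots> = (\<lambda>q. (q, generated ?R q)) ` (\<phi> ` (R `` {x}))"
    proof (rule image_cong[OF refl])
      fix q assume "q \<in> \<phi> ` (R `` {x})"
      then have "(\<phi> x, q) \<in> ?R"
        unfolding Rx[symmetric] by simp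
      then show "(q, generated (generated ?R (\<phi> x)) q) = (q, generated ?R q)"
        by (simp add: generated_generated)
    qed
    finally show ?thesis
      by (simp add: image_image tag_def)
  qed
  have ord: "(?t x, ?t y) \<in> M" if "x \<in> V" "y \<in> V" "(x, y) \<in> L" for x y
  proof (cases "x = y")
    case True
    then show ?thesis
      using M(1) t[OF that(1)] by (auto simp: order_on_defs refl_on_def)
  next
    case False
    then have "fst (?t x) < fst (?t y)"
      using \<phi>(1) that by (auto simp: increasing_on_def tag_def)
    then show ?thesis
      using M(2) t that by blast
  qed
  have "univ_arcs k N \<subseteq> ?U \<times> ?U"
    using k_arcs_univ unfolding k_arcs_def by blast
  then have "(map_prod h h ` univ_arcs k N) `` {h (?t x)} = (h \<circ> ?t) ` (R `` {x})" if "x \<in> V" for x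
    using image_arcs_Image[OF h _ t[OF that]] succ[OF that] by (simp add: image_comp)
  then show ?thesis
    unfolding embedding_struct_of_iff[OF R k_arcs_image[OF h k_arcs_univ]]
    using t hinj ord by auto
qed

text \<open>Undoing the tagging turns \<open>g\<close> into an embedding of the first structure into
  the second, and \<open>\<psi>\<close> reads off the positions. Its image is successor-closed, so
  by \<open>tag_comp\<close> the tags computed in the large structure are those computed from
  \<open>\<psi>\<close> alone.\<close>

lemma embedding_into_tagged:
  assumes A: "k_arcs k V R" "linear_order_on V L"
    and B: "k_arcs k W S" "linear_order_on W M"
    and \<phi>: "increasing_on W M \<phi>" and inj: "inj_on (h \<circ> tag \<phi> S) W"
    and g: "embedding g (struct_of k V R L) (image_struct (h \<circ> tag \<phi> S) (struct_of k W S M))"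
  obtains \<psi> where "increasing_on V L \<psi>" "\<psi> ` V \<subseteq> \<phi> ` W"
    "\<And>x. x \<in> V \<Longrightarrow> g x = h (tag \<psi> R x)"
proof -
  let ?t = "h \<circ> tag \<phi> S"
  have RV: "R \<subseteq> V \<times> V" and SW: "S \<subseteq> W \<times> W" and MW: "M \<subseteq> W \<times> W"
    using A B by (auto simp: k_arcs_def order_on_defs)
  have g: "g ` V \<subseteq> ?t ` W" "inj_on g V"
    "\<And>x y. x \<in> V \<Longrightarrow> y \<in> V \<Longrightarrow> (x, y) \<in> L \<Longrightarrow> (g x, g y) \<in> map_prod ?t ?t ` M"
    "\<And>x. x \<in> V \<Longrightarrow> (map_prod ?t ?t ` S) `` {g x} = g ` (R `` {x})"
    using g unfolding image_struct_struct_of[OF inj SW]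
      embedding_struct_of_iff[OF A(1) k_arcs_image[OF inj B(1)]] by (elim conjE bspec; simp only:)+
  define g' where "g' = inv_into W ?t \<circ> g"
  have g': "g' x \<in> W" "?t (g' x) = g x" if "x \<in> V" for x
  proof -
    have "g x \<in> ?t ` W"
      using g(1) that by blast
    then show "g' x \<in> W" "?t (g' x) = g x"
      unfolding g'_def o_apply[of "inv_into W ?t"] by (rule inv_into_into, rule f_inv_into_f)
  qed
  have g'_inj: "inj_on g' V"
    using g(2) g'(2) by (metis inj_on_def)
  have g'_mono: "(g' x, g' y) \<in> M" if "x \<in> V" "y \<in> V" "(x, y) \<in> L" for x y
    using g(3)[OF that] g' that map_prod_inj_mem[OF inj MW, of "g' x" "g' y"] by simp
  have g'_succ: "S `` {g' x} = g' ` (R `` {x})" if x: "x \<in> V" for x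
  proof -
    have "?t ` (S `` {g' x}) = g ` (R `` {x})"
      using image_arcs_Image[OF inj SW g'(1)[OF x]] g'(2)[OF x] g(4)[OF x] by simp
    also have "\<dots> = ?t ` (g' ` (R `` {x}))"
      unfolding image_image by (rule image_cong) (use RV g'(2) in auto)
    finally show ?thesis
      by (subst (asm) inj_on_image_eq_iff[OF inj]) (use SW RV g'(1) in auto)
  qed
  show thesis
  proof
    show "increasing_on V L (\<phi> \<circ> g')"
      using \<phi> g' g'_mono inj_on_eq_iff[OF g'_inj] by (simp add: increasing_on_def)
    show "(\<phi> \<circ> g') ` V \<subseteq> \<phi> ` W"
      using g' by auto
    fix x assume x: "x \<in> V"
    have "tag (\<phi> \<circ> g') R x = tag \<phi> S (g' x)"
      by (rule tag_comp[OF increasing_on_inj_on[OF B(2) \<phi>] g'_inj _ SW RV g'_succ x])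
        (use g' in auto)
    then show "g x = h (tag (\<phi> \<circ> g') R x)"
      using g'(2)[OF x] by simp
  qed
qed

section \<open>Colouring position sets and extracting a homogeneous copy\<close>

theorem theorem6p1:
  fixes k :: nat
  assumes "k \<ge> 1" and "infinite (UNIV :: 'v set)"
  shows "ramsey_class (ord_D_plus k :: 'v ord_fstruct set)"
  unfolding ramsey_class_def
proof (intro ballI allI impI)
  fix A B :: "'v ord_fstruct" and r :: nat
  assume "A \<in> ord_D_plus k" "B \<in> ord_D_plus k" and r: "1 \<le> r"
  then obtain V R L W S M where A: "A = struct_of k V R L" "k_arcs k V R" "linear_order_on V L"
    and B: "B = struct_of k W S M" "k_arcs k W S" "linear_order_on W M"
    by (metis ord_D_plusE)
  have fin: "finite V" "finite W" and RV: "R \<subseteq> V \<times> V" "L \<subseteq> V \<times> V"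
    using A B by (auto simp: k_arcs_def order_on_defs)
  \<comment> \<open>Ramsey's theorem for \<open>card V\<close>-subsets in \<open>r\<close> colours,
    with a homogeneous set of size \<open>card W\<close> demanded for every colour.\<close>
  obtain N where N: "partn_lst {..<N::nat} (replicate r (card W)) (card V)"
    using ramsey_full by blast
  obtain Q where Q: "linear_order_on (univ_verts k N) Q"
    "\<And>x y. x \<in> univ_verts k N \<Longrightarrow> y \<in> univ_verts k N \<Longrightarrow> fst x < fst y \<Longrightarrow> (x, y) \<in> Q"
    using ex_univ_order by blast
  \<comment> \<open>The universal structure is finite, so it can be renamed into the infinite type
    \<open>'v\<close>.\<close>
  obtain h :: "nat \<times> nat rel \<Rightarrow> 'v" where h: "inj_on h (univ_verts k N)"
    using inj_on_iff_card_le finite_univ_verts infinite_arbitrarily_large[OF assms(2)]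
    by (metis order_refl)
  define C where "C = struct_of k (h ` univ_verts k N) (map_prod h h ` univ_arcs k N)
    (map_prod h h ` Q)"
  have "C \<in> ord_D_plus k"
    unfolding C_def
    by (intro struct_of_in_ord_D_plus k_arcs_image k_arcs_univ linear_order_on_image h Q)
  moreover have "\<exists>B'\<in>copies B C. \<exists>i<r. copies A B' \<subseteq> P i"
    if P: "partition_into r P (copies A C)" for P
  proof -
    \<comment> \<open>Each position set gets its one increasing enumeration by \<open>V\<close>,
      hence one canonical copy of \<open>A\<close>.\<close>
    define \<phi> where "\<phi> Y = (SOME \<phi>. increasing_on V L \<phi> \<and> \<phi> ` V = Y)" for Y
    have \<phi>: "increasing_on V L (\<phi> Y)" "\<phi> Y ` V = Y" if "Y \<in> nsets {..<N} (card V)" for Y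
    proof -
      have "\<exists>\<phi>. increasing_on V L \<phi> \<and> \<phi> ` V = Y"
        using ex_increasing_on[OF fin(1) A(3), of Y] that unfolding nsets_def by blast
      then have "increasing_on V L (\<phi> Y) \<and> \<phi> Y ` V = Y"
        unfolding \<phi>_def by (rule someI_ex)
      then show "increasing_on V L (\<phi> Y)" "\<phi> Y ` V = Y"
        by auto
    qed
    define copy where "copy Y = image_struct (h \<circ> tag (\<phi> Y) R) A" for Y
    have "\<exists>i<r. copy Y \<in> P i" if Y: "Y \<in> nsets {..<N} (card V)" for Y
    proof -
      have "\<phi> Y ` V \<subseteq> {..<N}"
        using \<phi>(2)[OF Y] Y by (simp add: nsets_def)
      then have "copy Y \<in> copies A C"
        unfolding copies_def copy_def C_def A(1)
        using tag_embedding[OF A(2,3) \<phi>(1)[OF Y] _ Q h] by blast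
      then show ?thesis
        using P by (auto simp: partition_into_def)
    qed
    \<comment> \<open>The colour of a position set is the index of the class containing its
      canonical copy.\<close>
    then obtain c where c: "\<And>Y. Y \<in> nsets {..<N} (card V) \<Longrightarrow> c Y < r \<and> copy Y \<in> P (c Y)"
      by metis
    then have "c \<in> nsets {..<N} (card V) \<rightarrow> {..<length (replicate r (card W))}"
      by auto
    \<comment> \<open>If \<open>A\<close> has more vertices than \<open>B\<close>, then
      \<open>X\<close> has no \<open>card V\<close>-subsets and homogeneity is vacuous.\<close>
    then obtain i X where i: "i < r" and X: "X \<in> nsets {..<N} (card W)"
      and mono: "c ` nsets X (card V) \<subseteq> {i}"
      using N unfolding partn_lst_def monochromatic_def
      by (metis length_replicate nth_replicate)
    obtain \<beta> where \<beta>: "increasing_on W M \<beta>" "\<beta> ` W = X"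
      using ex_increasing_on[OF fin(2) B(3), of X] X unfolding nsets_def by blast
    have XN: "X \<subseteq> {..<N}"
      using X by (simp add: nsets_def)
    define t where "t = h \<circ> tag \<beta> S"
    \<comment> \<open>The copy of \<open>B\<close> sought has exactly the homogeneous set
      \<open>X\<close> as its positions.\<close>
    have emb: "embedding t B C"
      unfolding t_def B(1) C_def by (rule tag_embedding[OF B(2,3) \<beta>(1) _ Q h]) (use \<beta> XN in simp)
    then have inj: "inj_on (h \<circ> tag \<beta> S) W"
      by (simp add: embedding_def t_def B(1))
    have "D \<in> P i" if D: "D \<in> copies A (image_struct t B)" for D
    proof -
      obtain g where g: "D = image_struct g A" "embedding g A (image_struct t B)"
        using D by (auto simp: copies_def)
      obtain \<psi> where \<psi>: "increasing_on V L \<psi>" "\<psi> ` V \<subseteq> X"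
        "\<And>x. x \<in> V \<Longrightarrow> g x = h (tag \<psi> R x)"
        using embedding_into_tagged[OF A(2,3) B(2,3) \<beta>(1) inj] g(2) \<beta>(2)
        unfolding A(1) B(1) t_def by metis
      define Y where "Y = \<psi> ` V"
      have YX: "Y \<in> nsets X (card V)"
        using \<psi>(2) fin(1) increasing_on_inj_on[OF A(3) \<psi>(1)]
        by (simp add: Y_def nsets_def card_image)
      then have YN: "Y \<in> nsets {..<N} (card V)"
        using nsets_mono[OF XN] by blast
      \<comment> \<open>Both maps enumerate \<open>Y\<close> increasingly, so they coincide on
        \<open>V\<close>. Hence \<open>D\<close> is the canonical copy on \<open>Y\<close>, whose
        colour is \<open>i\<close> because \<open>Y\<close> lies in \<open>X\<close>.\<close>
      have eq: "\<psi> x = \<phi> Y x" if "x \<in> V" for x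
        using increasing_on_unique[OF fin(1) A(3) \<psi>(1) \<phi>(1)[OF YN] _ that] \<phi>(2)[OF YN]
        by (simp add: Y_def)
      have "g x = (h \<circ> tag (\<phi> Y) R) x" if "x \<in> V" for x
        using \<psi>(3)[OF that] tag_cong[OF eq RV(1) that] by simp
      moreover have "inj_on g V"
        using g(2) by (simp add: embedding_def A(1))
      ultimately have "D = copy Y"
        unfolding g(1) copy_def A(1) using image_struct_cong[OF _ RV] by blast
      then show ?thesis
        using c[OF YN] mono YX by auto
    qed
    moreover have "image_struct t B \<in> copies B C"
      using emb by (auto simp: copies_def)
    ultimately show ?thesis
      using i by blast
  qed
  ultimately show "\<exists>C\<in>ord_D_plus k. \<forall>P. partition_into r P (copies A C) \<longrightarrow>
      (\<exists>B'\<in>copies B C. \<exists>i<r. copies A B' \<subseteq> P i)"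
    by blast
qed

end
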